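(* Let $A\in\mathbb{R}^{m\times n}$, $b\in\mathbb{R}^m$, $\sigma\ge 0$, $p\in\{1,2\}$, and let $\phi:\mathbb{R}_+\to\mathbb{R}_+$ be continuous and nondecreasing with $\phi(0)=0$. Assume that $\{x\in\mathbb{R}^n:\|Ax-b\|_p\le\sigma\}$ is nonempty. If $\phi(z)=0$ for $z\le\sigma$ and $\phi(z)>0$ for $z>\sigma$, then there exists $\lambda^*>0$ such that for every $\lambda>\lambda^*$ the problems $\min\{\|x\|_0:\|Ax-b\|_p\le\sigma,\ x\in\mathbb{R}^n\}$ and $\min\{\|x\|_0+\lambda\phi(\|Ax-b\|_p):x\in\mathbb{R}^n\}$ have the same optimal solution set.
   Context: $\mathbb{R}_+=[0,+\infty)$; $\|x\|_0$ is the number of nonzero components of $x$; "optimal solution set" means the set of all global minimizers. *)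

theory Defs
  imports "HOL-Analysis.Analysis"
begin

definition l0 :: "real ^ 'n \<Rightarrow> nat" where
  "l0 x = card {i. x $ i \<noteq> 0}"

(* Only meaningful for p \<ge> 1: root 0 is constantly 0. *)
definition lp_norm :: "nat \<Rightarrow> real ^ 'n \<Rightarrow> real" where
  "lp_norm p x = root p (\<Sum>i\<in>UNIV. \<bar>x $ i\<bar> ^ p)"

definition optimal_solutions :: "('a \<Rightarrow> 'b::linorder) \<Rightarrow> 'a set \<Rightarrow> 'a set" where
  "optimal_solutions f S = {x. is_arg_min f (\<lambda>y. y \<in> S) x}"

end

theory Submission
  imports Defs
begin

text \<open>The residuals $Ax - b$ of vectors $x$ with fewer than $k$ nonzero entries, where $k$ is the
  constrained optimum, form a finite union of affine subspaces, hence a closed set. It misses the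
  compact ball of radius $\sigma$, so the residual norms on it are bounded away from $\sigma$ by some
  $c > \sigma$. Sparser vectors therefore pay a penalty of at least $\lambda\phi(c)$, which exceeds
  $k$ once $\lambda > (k + 1)/\phi(c)$.\<close>

lemma lp_norm_nonneg: "lp_norm p x \<ge> 0"
  unfolding lp_norm_def by (cases "p = 0") (auto intro!: real_root_ge_zero sum_nonneg)

lemma component_le_lp_norm:
  assumes "p > 0"
  shows "\<bar>x $ i\<bar> \<le> lp_norm p x"
proof -
  have "\<bar>x $ i\<bar> ^ p \<le> (\<Sum>i\<in>UNIV. \<bar>x $ i\<bar> ^ p)"
    by (rule member_le_sum) auto
  then have "root p (\<bar>x $ i\<bar> ^ p) \<le> lp_norm p x"
    unfolding lp_norm_def using assms by (rule real_root_le_mono[rotated])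
  then show ?thesis
    using assms by (simp add: real_root_power_cancel)
qed

lemma continuous_on_lp_norm: "continuous_on S (lp_norm p)"
  unfolding lp_norm_def by (intro continuous_intros)

text \<open>Coordinates are bounded by \<open>lp_norm p x\<close>, so the l1 norm bounds the
  Euclidean norm; no triangle inequality for \<open>lp_norm\<close> is required.\<close>

lemma compact_lp_norm_le:
  fixes c :: real
  assumes "p > 0"
  shows "compact {x :: real ^ 'n. lp_norm p x \<le> c}"
proof -
  have "norm x \<le> real CARD('n) * c" if "lp_norm p x \<le> c" for x :: "real ^ 'n"
  proof -
    have "norm x \<le> (\<Sum>i\<in>UNIV. \<bar>x $ i\<bar>)"
      by (rule norm_le_l1_cart)
    also have "\<dots> \<le> (\<Sum>i\<in>(UNIV :: 'n set). c)"
      by (intro sum_mono order_trans[OF component_le_lp_norm[OF assms] that])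
    finally show ?thesis
      by simp
  qed
  then have "bounded {x :: real ^ 'n. lp_norm p x \<le> c}"
    unfolding bounded_iff by blast
  moreover have "closed {x :: real ^ 'n. lp_norm p x \<le> c}"
    by (intro closed_Collect_le continuous_on_lp_norm continuous_on_const)
  ultimately show ?thesis
    by (simp add: compact_eq_bounded_closed)
qed

text \<open>Cutting \<open>C\<close> down to a slightly larger ball makes it compact, so the norm
  attains its minimum there. The radius \<open>\<sigma> + 1\<close> is an arbitrary choice above
  \<sigma>.\<close>

lemma closed_lp_norm_separation:
  fixes C :: "(real ^ 'n) set" and \<sigma> :: real
  assumes "p > 0" and "closed C" and gt: "\<And>y. y \<in> C \<Longrightarrow> lp_norm p y > \<sigma>"
  obtains c where "c > \<sigma>" and "\<And>y. y \<in> C \<Longrightarrow> lp_norm p y \<ge> c"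
\<comment> \<open>The minimum is attained only on a nonempty set; the first case also covers empty
  \<open>C\<close>.\<close>
proof (cases "C \<inter> {y. lp_norm p y \<le> \<sigma> + 1} = {}")
  case True
  then show ?thesis
    using that[of "\<sigma> + 1"] by fastforce
next
  case False
  have "compact (C \<inter> {y. lp_norm p y \<le> \<sigma> + 1})"
    using assms compact_lp_norm_le by (intro closed_Int_compact) auto
  then obtain y0 where "y0 \<in> C"
      and y0: "\<And>y. y \<in> C \<Longrightarrow> lp_norm p y \<le> \<sigma> + 1 \<Longrightarrow> lp_norm p y0 \<le> lp_norm p y"
    using continuous_attains_inf[OF _ False continuous_on_lp_norm, of p] by auto
  \<comment> \<open>Points of \<open>C\<close> inside the ball have norm at least that of
    \<open>y0\<close>, and the others exceed \<open>\<sigma> + 1\<close>.\<close>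
  show ?thesis
  proof (rule that[of "min (\<sigma> + 1) (lp_norm p y0)"])
    show "min (\<sigma> + 1) (lp_norm p y0) > \<sigma>"
      using gt[OF \<open>y0 \<in> C\<close>] by simp
    show "lp_norm p y \<ge> min (\<sigma> + 1) (lp_norm p y0)" if "y \<in> C" for y
      using y0[OF that] by linarith
  qed
qed

text \<open>A linear image of a closed set may fail to be closed, but that of a subspace is closed
  in finite dimension. So the sparse vectors are split by a set \<open>S\<close> containing their
  support, with only finitely many choices of \<open>S\<close>.\<close>

lemma closed_sparse_residuals:
  fixes A :: "real ^ 'n ^ 'm" and b :: "real ^ 'm"
  shows "closed ((\<lambda>x. A *v x - b) ` {x. l0 x < k})"
proof -
  define V where "V S = {x :: real ^ 'n. \<forall>i. i \<notin> S \<longrightarrow> x $ i = 0}" for S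
  have "subspace (V S)" for S
    unfolding V_def subspace_def by auto
  then have "closed ((*v) A ` V S)" for S
    by (intro closed_subspace linear_subspace_image matrix_vector_mul_linear)
  then have "closed ((\<lambda>y. - b + y) ` (*v) A ` V S)" for S
    by (rule closed_translation)
  then have *: "closed (\<Union>S\<in>{S. card S < k}. (\<lambda>y. - b + y) ` (*v) A ` V S)"
    by (intro closed_UN) auto
  have "l0 x < k \<longleftrightarrow> (\<exists>S. card S < k \<and> x \<in> V S)" for x
  proof
    assume "l0 x < k"
    then show "\<exists>S. card S < k \<and> x \<in> V S"
      unfolding l0_def V_def by (intro exI[of _ "{i. x $ i \<noteq> 0}"]) auto
  next
    assume "\<exists>S. card S < k \<and> x \<in> V S"
    then obtain S where "card S < k" and "{i. x $ i \<noteq> 0} \<subseteq> S"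
      unfolding V_def by auto
    then show "l0 x < k"
      unfolding l0_def using card_mono[of S "{i. x $ i \<noteq> 0}"] by simp
  qed
  then have "{x. l0 x < k} = (\<Union>S\<in>{S. card S < k}. V S)"
    by auto
  then have "(\<lambda>x. A *v x - b) ` {x. l0 x < k}
      = (\<Union>S\<in>{S. card S < k}. (\<lambda>y. - b + y) ` (*v) A ` V S)"
    by (simp add: image_UN image_image)
  with * show ?thesis
    by simp
qed

text \<open>Rewriting both solution sets as level sets at the common optimal value \<open>k\<close>
  reduces their equality to a pointwise equivalence.\<close>

lemma optimal_solutions_eq:
  assumes "x0 \<in> S" and "f x0 = k" and "\<And>x. x \<in> S \<Longrightarrow> k \<le> f x"
  shows "optimal_solutions f S = {x \<in> S. f x = k}"
  using assms unfolding optimal_solutions_def is_arg_min_def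
  by (auto simp: not_less intro: antisym)

theorem corollary5p2:
  fixes A :: "real ^ 'n ^ 'm" and b :: "real ^ 'm"
    and \<sigma> :: real and p :: nat and \<phi> :: "real \<Rightarrow> real"
  assumes "\<sigma> \<ge> 0"
    and "p \<in> {1, 2}"
    and "\<phi> ` {0..} \<subseteq> {0..}"
    and "continuous_on {0..} \<phi>"
    and "mono_on {0..} \<phi>"
    and "\<phi> 0 = 0"
    and "{x. lp_norm p (A *v x - b) \<le> \<sigma>} \<noteq> {}"
    and "\<And>z. 0 \<le> z \<Longrightarrow> z \<le> \<sigma> \<Longrightarrow> \<phi> z = 0"
    and "\<And>z. z > \<sigma> \<Longrightarrow> \<phi> z > 0"
  shows "\<exists>L>0. \<forall>l>L.
    optimal_solutions l0 {x. lp_norm p (A *v x - b) \<le> \<sigma>} =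
    optimal_solutions (\<lambda>x. real (l0 x) + l * \<phi> (lp_norm p (A *v x - b))) UNIV"
proof -
  define N where "N x = lp_norm p (A *v x - b)" for x
  have "p > 0"
    using \<open>p \<in> {1, 2}\<close> by auto
  \<comment> \<open>A minimizer exists because \<open>l0\<close> takes values in the natural
    numbers.\<close>
  obtain x0 where x0: "N x0 \<le> \<sigma>" and min: "\<And>x. N x \<le> \<sigma> \<Longrightarrow> l0 x0 \<le> l0 x"
    using assms(7) ex_has_least_nat[of "\<lambda>x. N x \<le> \<sigma>" _ l0] unfolding N_def by auto
  define k where "k = l0 x0"
  have "lp_norm p y > \<sigma>" if "y \<in> (\<lambda>x. A *v x - b) ` {x. l0 x < k}" for y
    using that min unfolding k_def N_def by (force simp: not_le[symmetric])
  then obtain c where "c > \<sigma>"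
      and "\<And>y. y \<in> (\<lambda>x. A *v x - b) ` {x. l0 x < k} \<Longrightarrow> lp_norm p y \<ge> c"
    using closed_lp_norm_separation[OF \<open>p > 0\<close> closed_sparse_residuals] by blast
  then have c: "N x \<ge> c" if "l0 x < k" for x
    using that unfolding N_def by blast
  have "\<phi> c > 0"
    using assms(9) \<open>c > \<sigma>\<close> by blast
  have feas: "\<phi> (N x) = 0" if "N x \<le> \<sigma>" for x
    using assms(8) that lp_norm_nonneg unfolding N_def by blast
  have "optimal_solutions l0 {x. N x \<le> \<sigma>} =
      optimal_solutions (\<lambda>x. real (l0 x) + l * \<phi> (N x)) UNIV"
    if l: "l > (real k + 1) / \<phi> c" for l
  proof -
    let ?F = "\<lambda>x. real (l0 x) + l * \<phi> (N x)"
    have "l > 0"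
      using l \<open>\<phi> c > 0\<close> by (meson add_nonneg_pos divide_pos_pos less_trans of_nat_0_le_iff zero_less_one)
    \<comment> \<open>If \<open>l0 x < k\<close>, monotonicity of \<phi> makes the penalty alone
      exceed \<open>k\<close>. Otherwise \<open>l0 x\<close> is already at least \<open>k\<close>,
      and any positive penalty makes the inequality strict.\<close>
    have infeas: "?F x > k" if "N x > \<sigma>" for x
    proof (cases "l0 x < k")
      case True
      then have "\<phi> c \<le> \<phi> (N x)"
        using c \<open>c > \<sigma>\<close> \<open>\<sigma> \<ge> 0\<close> by (intro mono_onD[OF assms(5)]) force+
      then have "l * \<phi> c \<le> l * \<phi> (N x)"
        using \<open>l > 0\<close> by simp
      moreover have "real k + 1 < l * \<phi> c"
        using l \<open>\<phi> c > 0\<close> by (simp add: pos_divide_less_eq)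
      ultimately show ?thesis
        by linarith
    next
      case False
      moreover have "l * \<phi> (N x) > 0"
        using \<open>l > 0\<close> assms(9) that by simp
      ultimately show ?thesis
        by linarith
    qed
    have "optimal_solutions l0 {x. N x \<le> \<sigma>} = {x \<in> {x. N x \<le> \<sigma>}. l0 x = k}"
      using x0 min by (intro optimal_solutions_eq[of x0]) (auto simp: k_def)
    also have "\<dots> = {x \<in> UNIV. ?F x = k}"
    proof -
      \<comment> \<open>On feasible points the penalty vanishes and \<open>?F\<close> agrees with
        \<open>l0\<close>; at infeasible points both sides are false, which is where strictness in
        \<open>infeas\<close> matters.\<close>
      have "N x \<le> \<sigma> \<and> l0 x = k \<longleftrightarrow> ?F x = k" for x
        using feas[of x] infeas[of x] by (cases "N x \<le> \<sigma>") auto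
      then show ?thesis
        by auto
    qed
    also have "\<dots> = optimal_solutions ?F UNIV"
    proof (rule optimal_solutions_eq[of x0, symmetric])
      show "?F x0 = k"
        using feas[OF x0] by (simp add: k_def)
      show "k \<le> ?F x" for x
        using feas[of x] infeas[of x] min[of x] by (cases "N x \<le> \<sigma>") (auto simp: k_def)
    qed simp
    finally show ?thesis .
  qed
  moreover have "(real k + 1) / \<phi> c > 0"
    using \<open>\<phi> c > 0\<close> by (simp add: add_nonneg_pos)
  ultimately show ?thesis
    unfolding N_def by blast
qed

end
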